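(* Let $\mathbf{a}\subset\mathbb{N}^n$ be a finite exponent set connected to $\mathbf{0}$ and let $\sigma$ be a series with given coefficients $\sigma_\alpha$, $\alpha\in\mathbf{a}$. Let $\mathbf{b}$ be the exponent set output by the Artinian Gorenstein border basis algorithm (described in the context) on this input, and let $s=|\mathbf{a}|$, $r=|\mathbf{b}|$, $\delta=|\partial\mathbf{b}|$. The complexity of the algorithm to compute the bases $\mathbf{p}$ and $\mathbf{q}$ is $\mathcal{O}((r+\delta)\,r\,s)$ arithmetic operations in $\mathbb{K}$.
   Context: Notation. $\mathbb{K}$ is a field, $\mathbb{K}[\mathbf{x}]=\mathbb{K}[x_1,\ldots,x_n]$. A sequence $\sigma=(\sigma_\alpha)_{\alpha\in\mathbb{N}^n}$ is identified with the linear form on $\mathbb{K}[\mathbf{x}]$ given by $\langle\sigma\mid\mathbf{x}^\alpha\rangle=\sigma_\alpha$ (and with the corresponding formal power series); $\langle p,q\rangle_\sigma:=\langle\sigma\mid pq\rangle$. For a set $E\subset\mathbb{N}^n$ of exponents, $\mathbf{x}^E=\{\mathbf{x}^\alpha:\alpha\in E\}$, $\langle\cdot\rangle$ applied to a set of polynomials denotes its $\mathbb{K}$-linear span, $E^+=E\cup\bigcup_{i=1}^n(e_i+E)$ ($e_i$ the $i$-th unit vector), $\partial E=E^+\setminus E$. $E$ is connected to $\mathbf{0}$ if $\mathbf{0}\in E$ and every nonzero $\alpha\in E$ is $\alpha'+e_i$ for some $\alpha'\in E$ and some $i$. Complexity is arithmetic complexity: the number of arithmetic operations in $\mathbb{K}$.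 Procedure $\operatorname{proj}(f,[p_1,\ldots,p_l],[m_1,\ldots,m_l])$: set $g=f$; for $i=1,\ldots,l$ successively replace $g$ by $g-\langle g,m_i\rangle_\sigma\,p_i$; return $g$. Algorithm (Artinian Gorenstein border basis). Input: the coefficients $\sigma_\alpha$, $\alpha\in\mathbf{a}$, of a series $\sigma$, where $\mathbf{a}\subset\mathbb{N}^n$ is a finite list of exponents connected to $\mathbf{0}$. Initialize $\mathbf{b}=[\,]$, $\mathbf{c}=[\,]$, $\mathbf{d}=[\,]$, $\mathbf{n}=[\mathbf{0}]$, $\mathbf{s}=\mathbf{a}$, $\mathbf{t}=\mathbf{a}$. While $\mathbf{n}\neq\emptyset$: for each $\alpha\in\mathbf{n}$ successively, (a) set $p_\alpha=\operatorname{proj}(\mathbf{x}^\alpha,[p_\beta]_{\beta\in\mathbf{b}},[m_\beta]_{\beta\in\mathbf{b}})$; (b) find the first $\gamma$ in the list $\mathbf{t}$ such that $\mathbf{x}^\gamma p_\alpha\in\langle\mathbf{x}^{\mathbf{a}}\rangle$ and $\langle p_\alpha,\mathbf{x}^\gamma\rangle_\sigma\neq0$; (c) if such a $\gamma$ exists, set $m_\alpha=\frac{1}{\langle p_\alpha,\mathbf{x}^\gamma\rangle_\sigma}\mathbf{x}^\gamma$ and $q_\alpha=\operatorname{proj}(m_\alpha,[q_\beta]_{\beta\in\mathbf{b}},[p_\beta]_{\beta\in\mathbf{b}})$; then add $\alpha$ to $\mathbf{b}$ and remove it from $\mathbf{s}$, add $\gamma$ to $\mathbf{c}$ and remove it from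 $\mathbf{t}$. Otherwise add $\alpha$ to $\mathbf{d}$ and remove it from $\mathbf{s}$. After treating all $\alpha\in\mathbf{n}$, set $\mathbf{n}=\operatorname{next}(\mathbf{b},\mathbf{d},\mathbf{c},\mathbf{s})$, the set of $\alpha\in\partial\mathbf{b}\cap\mathbf{s}$ not in $\mathbf{d}$ such that $\alpha+\gamma\in\mathbf{a}$ for all $\gamma\in\mathbf{c}$. Output: $\mathbf{b}$, $\mathbf{c}$, $\mathbf{p}=[p_\beta]_{\beta\in\mathbf{b}}$, $\mathbf{q}=[q_\beta]_{\beta\in\mathbf{b}}$, and the relations $\mathbf{k}=[p_\alpha]_{\alpha\in\mathbf{d}}$. *)

theory Defs
  imports
    Complex_Main
    "HOL-Library.Poly_Mapping"
    "HOL-Library.While_Combinator"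
begin

section \<open>Exponents, polynomials and series\<close>

text \<open>
  An exponent is a finitely supported map from variable indices to \<open>nat\<close>; \<open>\<nat>\<^sup>n\<close> consists of those
  supported in \<open>{..<n}\<close>.  This allows the number \<open>n\<close> of variables to be quantified over.
\<close>

type_synonym expo = "nat \<Rightarrow>\<^sub>0 nat"
type_synonym 'a mpol = "expo \<Rightarrow>\<^sub>0 'a"

definition exponents :: "nat \<Rightarrow> expo set" where
  "exponents n = {\<alpha>. Poly_Mapping.keys \<alpha> \<subseteq> {..<n}}"

definition unit_vec :: "nat \<Rightarrow> expo" where
  "unit_vec i = Poly_Mapping.single i 1"

definition exp_plus :: "nat \<Rightarrow> expo set \<Rightarrow> expo set" where
  "exp_plus n E = E \<union> (\<Union>i<n. (\<lambda>\<alpha>. unit_vec i + \<alpha>) ` E)"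

definition border :: "nat \<Rightarrow> expo set \<Rightarrow> expo set" where
  "border n E = exp_plus n E - E"

definition connected_to_0 :: "nat \<Rightarrow> expo set \<Rightarrow> bool" where
  "connected_to_0 n E \<longleftrightarrow>
     0 \<in> E \<and> (\<forall>\<alpha>\<in>E. \<alpha> \<noteq> 0 \<longrightarrow> (\<exists>\<alpha>'\<in>E. \<exists>i<n. \<alpha> = \<alpha>' + unit_vec i))"

definition xpow :: "expo \<Rightarrow> 'a::field mpol" where
  "xpow \<alpha> = Poly_Mapping.single \<alpha> 1"

definition smul :: "'a::field \<Rightarrow> 'a mpol \<Rightarrow> 'a mpol" where
  "smul k f = Poly_Mapping.single 0 k * f"

definition pol_span :: "'a::field mpol set \<Rightarrow> 'a mpol set" where
  "pol_span = module.span smul"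

definition lin_form :: "(expo \<Rightarrow> 'a::field) \<Rightarrow> 'a mpol \<Rightarrow> 'a" where
  "lin_form \<sigma> f = (\<Sum>\<alpha>\<in>Poly_Mapping.keys f. Poly_Mapping.lookup f \<alpha> * \<sigma> \<alpha>)"

definition pairing :: "(expo \<Rightarrow> 'a::field) \<Rightarrow> 'a mpol \<Rightarrow> 'a mpol \<Rightarrow> 'a" where
  "pairing \<sigma> f g = lin_form \<sigma> (f * g)"

section \<open>The algorithm\<close>

definition proj :: "(expo \<Rightarrow> 'a::field) \<Rightarrow> 'a mpol \<Rightarrow> 'a mpol list \<Rightarrow> 'a mpol list \<Rightarrow> 'a mpol" where
  "proj \<sigma> f ps ms = fold (\<lambda>(p, m) g. g - smul (pairing \<sigma> g m) p) (zip ps ms) f"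

text \<open>
  The lists \<open>b\<close> and \<open>c\<close> are aligned: \<open>c ! i\<close> is the exponent of \<open>m_\<beta>\<close> for \<open>\<beta> = b ! i\<close>.
  The families \<open>p\<close>, \<open>m\<close>, \<open>q\<close> are indexed by exponents.
\<close>

record (overloaded) 'a agstate =
  b_of :: "expo list"
  c_of :: "expo list"
  d_of :: "expo list"
  n_of :: "expo list"
  s_of :: "expo list"
  t_of :: "expo list"
  p_of :: "expo \<Rightarrow> 'a mpol"
  m_of :: "expo \<Rightarrow> 'a mpol"
  q_of :: "expo \<Rightarrow> 'a mpol"

definition next_exps ::
    "nat \<Rightarrow> expo list \<Rightarrow> expo list \<Rightarrow> expo list \<Rightarrow> expo list \<Rightarrow> expo list \<Rightarrow> expo set" where
  "next_exps n a b d c s =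
     {\<alpha> \<in> border n (set b) \<inter> set s. \<alpha> \<notin> set d \<and> (\<forall>\<gamma>\<in>set c. \<alpha> + \<gamma> \<in> set a)}"

text \<open>
  The set \<open>next_exps \<dots>\<close> may be traversed in any order.  The order is a parameter \<open>ord\<close>; since the
  sets traversed in a run are nonempty and pairwise disjoint, such an \<open>ord\<close> realises every possible
  sequence of choices.
\<close>

definition enumerates_sets :: "(expo set \<Rightarrow> expo list) \<Rightarrow> bool" where
  "enumerates_sets ord \<longleftrightarrow> (\<forall>A. finite A \<longrightarrow> distinct (ord A) \<and> set (ord A) = A)"

definition ag_treat ::
    "expo list \<Rightarrow> (expo \<Rightarrow> 'a::field) \<Rightarrow> expo \<Rightarrow> 'a agstate \<Rightarrow> 'a agstate" where
  "ag_treat a \<sigma> \<alpha> S =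
    (let b = b_of S; p = p_of S; m = m_of S; q = q_of S;
         p\<alpha> = proj \<sigma> (xpow \<alpha>) (map p b) (map m b)
     in case find (\<lambda>\<gamma>. xpow \<gamma> * p\<alpha> \<in> pol_span (xpow ` set a) \<and> pairing \<sigma> p\<alpha> (xpow \<gamma>) \<noteq> 0) (t_of S) of
          Some \<gamma> \<Rightarrow>
            let m\<alpha> = smul (1 / pairing \<sigma> p\<alpha> (xpow \<gamma>)) (xpow \<gamma>);
                q\<alpha> = proj \<sigma> m\<alpha> (map q b) (map p b)
            in S\<lparr>b_of := b @ [\<alpha>], s_of := remove1 \<alpha> (s_of S),
                 c_of := c_of S @ [\<gamma>], t_of := remove1 \<gamma> (t_of S),
                 p_of := p(\<alpha> := p\<alpha>), m_of := m(\<alpha> := m\<alpha>), q_of := q(\<alpha> := q\<alpha>)\<rparr>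
        | None \<Rightarrow>
            S\<lparr>d_of := d_of S @ [\<alpha>], s_of := remove1 \<alpha> (s_of S), p_of := p(\<alpha> := p\<alpha>)\<rparr>)"

definition ag_round ::
    "(expo set \<Rightarrow> expo list) \<Rightarrow> nat \<Rightarrow> expo list \<Rightarrow> (expo \<Rightarrow> 'a::field) \<Rightarrow> 'a agstate \<Rightarrow> 'a agstate" where
  "ag_round ord n a \<sigma> S =
    (let S' = fold (ag_treat a \<sigma>) (n_of S) S
     in S'\<lparr>n_of := ord (next_exps n a (b_of S') (d_of S') (c_of S') (s_of S'))\<rparr>)"

definition ag_init :: "expo list \<Rightarrow> 'a::field agstate" where
  "ag_init a = \<lparr>b_of = [], c_of = [], d_of = [], n_of = [0], s_of = a, t_of = a,
     p_of = (\<lambda>_. 0), m_of = (\<lambda>_. 0), q_of = (\<lambda>_. 0)\<rparr>"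

text \<open>The output consists of \<open>b\<close>, \<open>c\<close>, \<open>p\<close>, \<open>q\<close> and the relations \<open>k\<close>.\<close>

type_synonym 'a agoutput = "expo list \<times> expo list \<times> 'a mpol list \<times> 'a mpol list \<times> 'a mpol list"

definition ag_output :: "('a, 'z) agstate_scheme \<Rightarrow> 'a agoutput" where
  "ag_output S = (b_of S, c_of S, map (p_of S) (b_of S), map (q_of S) (b_of S), map (p_of S) (d_of S))"

text \<open>The result is \<open>None\<close> iff the while loop does not terminate.\<close>

definition ag_border_basis ::
    "(expo set \<Rightarrow> expo list) \<Rightarrow> nat \<Rightarrow> expo list \<Rightarrow> (expo \<Rightarrow> 'a::field) \<Rightarrow> 'a agoutput option" where
  "ag_border_basis ord n a \<sigma> =
     map_option ag_output (while_option (\<lambda>S. n_of S \<noteq> []) (ag_round ord n a \<sigma>) (ag_init a))"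

section \<open>Counting arithmetic operations\<close>

text \<open>
  A counted computation is a result together with the number of field operations performed.  Field
  elements are only ever combined by the four counted operations below, each of cost 1; operations
  on exponents, look-ups of coefficients and zero tests are not arithmetic operations in the field.
\<close>

type_synonym 'r counted = "'r \<times> nat"

definition ret :: "'r \<Rightarrow> 'r counted" where
  "ret x = (x, 0)"

definition bind_counted :: "'r counted \<Rightarrow> ('r \<Rightarrow> 't counted) \<Rightarrow> 't counted"
    (infixl \<open>\<bind>\<close> 54) where
  "M \<bind> F = (let (x, k) = M; (y, l) = F x in (y, k + l))"

definition addc :: "'a::field \<Rightarrow> 'a \<Rightarrow> 'a counted" where
  "addc x y = (x + y, 1)"

definition subc :: "'a::field \<Rightarrow> 'a \<Rightarrow> 'a counted" where
  "subc x y = (x - y, 1)"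

definition mulc :: "'a::field \<Rightarrow> 'a \<Rightarrow> 'a counted" where
  "mulc x y = (x * y, 1)"

definition divc :: "'a::field \<Rightarrow> 'a \<Rightarrow> 'a counted" where
  "divc x y = (x / y, 1)"

primrec foldc :: "('x \<Rightarrow> 's \<Rightarrow> 's counted) \<Rightarrow> 'x list \<Rightarrow> 's \<Rightarrow> 's counted" where
  "foldc f [] z = ret z"
| "foldc f (x # xs) z = f x z \<bind> foldc f xs"

text \<open>\<open>dotc z es u v\<close> computes \<open>z + (\<Sum>\<epsilon>\<leftarrow>es. u \<epsilon> * v \<epsilon>)\<close>.\<close>

definition dotc :: "'a::field \<Rightarrow> expo list \<Rightarrow> (expo \<Rightarrow> 'a) \<Rightarrow> (expo \<Rightarrow> 'a) \<Rightarrow> 'a counted" where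
  "dotc z es u v = foldc (\<lambda>\<epsilon> acc. mulc (u \<epsilon>) (v \<epsilon>) \<bind> addc acc) es z"

text \<open>\<open>submulc es g u f\<close> computes \<open>g - u f\<close> for \<open>f\<close> supported in \<open>es\<close>.\<close>

definition submulc :: "expo list \<Rightarrow> 'a::field mpol \<Rightarrow> 'a \<Rightarrow> 'a mpol \<Rightarrow> 'a mpol counted" where
  "submulc es g u f =
     foldc (\<lambda>\<epsilon> h. mulc u (Poly_Mapping.lookup f \<epsilon>) \<bind> (\<lambda>y.
                  subc (Poly_Mapping.lookup h \<epsilon>) y \<bind> (\<lambda>z.
                  ret (Poly_Mapping.update \<epsilon> z h)))) es g"

text \<open>
  The pairing of \<open>g\<close> with \<open>x^\<gamma>\<close>, for \<open>g\<close> supported in \<open>b\<close>, respectively for \<open>g\<close> that is the sum of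
  \<open>x^\<alpha>\<close> and a polynomial supported in \<open>b\<close>.  In the second case the coefficient 1 of \<open>x^\<alpha>\<close> requires
  no multiplication.
\<close>

definition momentc :: "(expo \<Rightarrow> 'a::field) \<Rightarrow> expo list \<Rightarrow> 'a mpol \<Rightarrow> expo \<Rightarrow> 'a counted" where
  "momentc \<sigma> b g \<gamma> = dotc 0 b (Poly_Mapping.lookup g) (\<lambda>\<beta>. \<sigma> (\<beta> + \<gamma>))"

definition monic_momentc ::
    "(expo \<Rightarrow> 'a::field) \<Rightarrow> expo \<Rightarrow> expo list \<Rightarrow> 'a mpol \<Rightarrow> expo \<Rightarrow> 'a counted" where
  "monic_momentc \<sigma> \<alpha> b g \<gamma> = dotc (\<sigma> (\<alpha> + \<gamma>)) b (Poly_Mapping.lookup g) (\<lambda>\<beta>. \<sigma> (\<beta> + \<gamma>))"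

text \<open>Counted version of the projection in step (a); \<open>m \<beta>\<close> is a multiple of \<open>x^\<gamma>\<close>.\<close>

definition proj_pc ::
    "(expo \<Rightarrow> 'a::field) \<Rightarrow> expo \<Rightarrow> expo list \<Rightarrow> expo list \<Rightarrow> (expo \<Rightarrow> 'a mpol) \<Rightarrow> (expo \<Rightarrow> 'a mpol)
      \<Rightarrow> 'a mpol counted" where
  "proj_pc \<sigma> \<alpha> b c p m =
     foldc (\<lambda>(\<beta>, \<gamma>) g. monic_momentc \<sigma> \<alpha> b g \<gamma> \<bind> (\<lambda>w.
                       mulc (Poly_Mapping.lookup (m \<beta>) \<gamma>) w \<bind> (\<lambda>u.
                       submulc b g u (p \<beta>)))) (zip b c) (xpow \<alpha>)"

text \<open>
  Counted version of step (b), returning the exponent found and the pairing computed for it.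
\<close>

primrec searchc ::
    "expo list \<Rightarrow> (expo \<Rightarrow> 'a::field) \<Rightarrow> expo \<Rightarrow> expo list \<Rightarrow> 'a mpol \<Rightarrow> expo list
      \<Rightarrow> (expo \<times> 'a) option counted" where
  "searchc a \<sigma> \<alpha> b p\<alpha> [] = ret None"
| "searchc a \<sigma> \<alpha> b p\<alpha> (\<gamma> # ts) =
     (if (\<lambda>\<delta>. \<gamma> + \<delta>) ` Poly_Mapping.keys p\<alpha> \<subseteq> set a
      then monic_momentc \<sigma> \<alpha> b p\<alpha> \<gamma> \<bind> (\<lambda>w.
             if w \<noteq> 0 then ret (Some (\<gamma>, w)) else searchc a \<sigma> \<alpha> b p\<alpha> ts)
      else searchc a \<sigma> \<alpha> b p\<alpha> ts)"

text \<open>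
  Counted version of the projection in step (c).  The pairing of \<open>g\<close> with \<open>p_\<beta>\<close> is evaluated as the
  sum over \<open>\<gamma>\<close> of \<open>g_\<gamma>\<close> times the pairing of \<open>p_\<beta>\<close> with \<open>x^\<gamma>\<close>, the latter being taken from a table
  \<open>M\<close> in which it was stored when \<open>\<beta>\<close> and \<open>\<gamma>\<close> were both accepted.  Here \<open>c\<close> contains the exponent
  of \<open>m\<alpha>\<close>.
\<close>

definition proj_qc ::
    "'a::field mpol \<Rightarrow> expo list \<Rightarrow> expo list \<Rightarrow> (expo \<Rightarrow> 'a mpol) \<Rightarrow> (expo \<Rightarrow> expo \<Rightarrow> 'a)
      \<Rightarrow> 'a mpol counted" where
  "proj_qc m\<alpha> b c q M =
     foldc (\<lambda>\<beta> g. dotc 0 c (Poly_Mapping.lookup g) (M \<beta>) \<bind> (\<lambda>u. submulc c g u (q \<beta>))) b m\<alpha>"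

record (overloaded) 'a cagstate = "'a agstate" +
  M_of :: "expo \<Rightarrow> expo \<Rightarrow> 'a"

text \<open>
  Extension of the table after \<open>\<alpha>\<close> and \<open>\<gamma>\<close> are accepted: the pairings of the previous \<open>p_\<beta>\<close> with
  \<open>x^\<gamma>\<close> and of \<open>p_\<alpha>\<close> with the previous elements of \<open>x^c\<close>; \<open>w\<close> is the pairing of \<open>p_\<alpha>\<close> with \<open>x^\<gamma>\<close>.
\<close>

definition extend_tablec ::
    "(expo \<Rightarrow> 'a::field) \<Rightarrow> expo list \<Rightarrow> expo list \<Rightarrow> (expo \<Rightarrow> 'a mpol) \<Rightarrow> expo \<Rightarrow> expo \<Rightarrow> 'a mpol \<Rightarrow> 'a
      \<Rightarrow> (expo \<Rightarrow> expo \<Rightarrow> 'a) \<Rightarrow> (expo \<Rightarrow> expo \<Rightarrow> 'a) counted" where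
  "extend_tablec \<sigma> b c p \<alpha> \<gamma> p\<alpha> w M =
     foldc (\<lambda>\<beta> M. momentc \<sigma> b (p \<beta>) \<gamma> \<bind> (\<lambda>v. ret (M(\<beta> := (M \<beta>)(\<gamma> := v))))) b M \<bind> (\<lambda>M.
     foldc (\<lambda>\<gamma>' M. monic_momentc \<sigma> \<alpha> b p\<alpha> \<gamma>' \<bind> (\<lambda>v. ret (M(\<alpha> := (M \<alpha>)(\<gamma>' := v))))) c M \<bind> (\<lambda>M.
     ret (M(\<alpha> := (M \<alpha>)(\<gamma> := w)))))"

definition ag_treatc ::
    "expo list \<Rightarrow> (expo \<Rightarrow> 'a::field) \<Rightarrow> expo \<Rightarrow> 'a cagstate \<Rightarrow> 'a cagstate counted" where
  "ag_treatc a \<sigma> \<alpha> S =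
    (let b = b_of S; c = c_of S; p = p_of S; m = m_of S; q = q_of S in
     proj_pc \<sigma> \<alpha> b c p m \<bind> (\<lambda>p\<alpha>.
     searchc a \<sigma> \<alpha> b p\<alpha> (t_of S) \<bind> (\<lambda>found.
     case found of
       Some (\<gamma>, w) \<Rightarrow>
         divc 1 w \<bind> (\<lambda>\<rho>.
         let m\<alpha> = Poly_Mapping.single \<gamma> \<rho> in
         extend_tablec \<sigma> b c p \<alpha> \<gamma> p\<alpha> w (M_of S) \<bind> (\<lambda>M.
         proj_qc m\<alpha> b (c @ [\<gamma>]) q M \<bind> (\<lambda>q\<alpha>.
         ret (S\<lparr>b_of := b @ [\<alpha>], s_of := remove1 \<alpha> (s_of S),
                c_of := c @ [\<gamma>], t_of := remove1 \<gamma> (t_of S),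
                p_of := p(\<alpha> := p\<alpha>), m_of := m(\<alpha> := m\<alpha>), q_of := q(\<alpha> := q\<alpha>), M_of := M\<rparr>))))
     | None \<Rightarrow>
         ret (S\<lparr>d_of := d_of S @ [\<alpha>], s_of := remove1 \<alpha> (s_of S), p_of := p(\<alpha> := p\<alpha>)\<rparr>))))"

definition ag_roundc ::
    "(expo set \<Rightarrow> expo list) \<Rightarrow> nat \<Rightarrow> expo list \<Rightarrow> (expo \<Rightarrow> 'a::field) \<Rightarrow> 'a cagstate
      \<Rightarrow> 'a cagstate counted" where
  "ag_roundc ord n a \<sigma> S =
    foldc (ag_treatc a \<sigma>) (n_of S) S \<bind> (\<lambda>S'.
    ret (S'\<lparr>n_of := ord (next_exps n a (b_of S') (d_of S') (c_of S') (s_of S'))\<rparr>))"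

definition ag_initc :: "expo list \<Rightarrow> 'a::field cagstate" where
  "ag_initc a = agstate.extend (ag_init a) (cagstate.fields (\<lambda>_ _. 0))"

definition ag_border_basisc ::
    "(expo set \<Rightarrow> expo list) \<Rightarrow> nat \<Rightarrow> expo list \<Rightarrow> (expo \<Rightarrow> 'a::field) \<Rightarrow> 'a agoutput counted option" where
  "ag_border_basisc ord n a \<sigma> =
     map_option (\<lambda>(S, ops). (ag_output S, ops))
       (while_option (\<lambda>(S, ops). n_of S \<noteq> []) (\<lambda>(S, ops). (S, ops) \<bind> ag_roundc ord n a \<sigma>)
         (ret (ag_initc a)))"

end

theory Submission
  imports Defs
begin

text \<open>
  Let \<open>l\<close> be the number of exponents accepted so far when an exponent \<open>\<alpha>\<close> is treated.
  For accepted \<open>\<beta>\<close>, all \<open>p\<^sub>\<beta>\<close> are supported in \<open>b\<close> (and \<open>p\<^sub>\<alpha>\<close> is \<open>x\<^sup>\<alpha>\<close> plus a polynomial supported in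
  \<open>b\<close>), all \<open>q\<^sub>\<beta>\<close> are supported in \<open>c\<close>, and both lists have length \<open>l\<close>; so every pairing and every
  update of a polynomial costs \<open>O(l)\<close>.  The two projections and the new row and column of the
  table of pairings need \<open>O(l)\<close> such steps each, and the search in \<open>t\<close> at most \<open>s\<close> of them.  Since
  \<open>l \<le> s\<close>, one treatment costs \<open>O(l s)\<close> if \<open>\<alpha>\<close> is rejected and \<open>O((l + 1) s)\<close> if it is accepted,
  hence \<open>O(r s)\<close> in both cases for the final value \<open>r\<close> of \<open>l\<close>.

  It remains to count the treated exponents.  Each of them is treated once, as it leaves \<open>s\<close>, and
  ends up in \<open>b\<close> or in \<open>d\<close>.  A rejected exponent lay in the border of an earlier \<open>b\<close> and is never
  accepted later, so it lies in the border of the final \<open>b\<close>, and at most \<open>r + \<delta>\<close> exponents are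
  treated.  The only exception is a rejected \<open>0\<close>; then \<open>r = 0\<close>, the loop stops at once and no
  arithmetic operation has been performed.

  The predicate \<open>ag_inv\<close> records these facts together with the correctness of the table,
  \<open>ag_treatc_correct\<close> shows that one counted treatment preserves it, agrees with the uncounted one
  and is paid for by the growth of \<open>ops_bound\<close>, and \<open>ops_bound_border\<close> replaces the number of
  rejected exponents by \<open>\<delta>\<close>.
\<close>

section \<open>Support and bilinearity of the pairing\<close>

lemma lookup_smul: "Poly_Mapping.lookup (smul k f) \<epsilon> = k * Poly_Mapping.lookup f \<epsilon>"
  unfolding smul_def
  by (simp add: mult_map_scale_conv_mult[symmetric] Poly_Mapping.map.rep_eq when_def)

lemma keys_smul_subset: "Poly_Mapping.keys (smul k f) \<subseteq> Poly_Mapping.keys f"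
  by (auto simp: in_keys_iff lookup_smul)

lemma keys_diff_smul_subset:
  assumes "Poly_Mapping.keys g \<subseteq> A" "Poly_Mapping.keys f \<subseteq> A"
  shows "Poly_Mapping.keys (g - smul u f) \<subseteq> A"
  using assms keys_diff[of g "smul u f"] keys_smul_subset[of u f] by blast

lemma module_smul: "module (smul :: 'a::field \<Rightarrow> 'a mpol \<Rightarrow> 'a mpol)"
  by unfold_locales
     (simp_all add: smul_def distrib_left distrib_right single_add mult_single
        mult.assoc[symmetric])

lemma sum_singles:
  fixes f :: "'a::field mpol"
  assumes "finite A" "Poly_Mapping.keys f \<subseteq> A"
  shows "f = (\<Sum>\<epsilon>\<in>A. Poly_Mapping.single \<epsilon> (Poly_Mapping.lookup f \<epsilon>))"
proof (rule poly_mapping_eqI)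
  fix \<epsilon>
  show "Poly_Mapping.lookup f \<epsilon> =
        Poly_Mapping.lookup (\<Sum>\<epsilon>\<in>A. Poly_Mapping.single \<epsilon> (Poly_Mapping.lookup f \<epsilon>)) \<epsilon>"
    using assms by (auto simp: lookup_sum lookup_single when_def in_keys_iff)
qed

text \<open>
  This turns the membership test in the search for \<open>\<gamma>\<close> into a comparison of exponents, which needs
  no arithmetic in the field.
\<close>

lemma pol_span_monomials:
  assumes "finite A"
  shows "pol_span (xpow ` A) = {f :: 'a::field mpol. Poly_Mapping.keys f \<subseteq> A}"
proof -
  interpret module "smul :: 'a \<Rightarrow> 'a mpol \<Rightarrow> 'a mpol"
    by (rule module_smul)
  show ?thesis
    unfolding pol_span_def
  proof
    have "subspace {f :: 'a mpol. Poly_Mapping.keys f \<subseteq> A}"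
    proof (rule subspaceI)
      fix f g :: "'a mpol" and k
      assume f: "f \<in> {f. Poly_Mapping.keys f \<subseteq> A}"
      then show "smul k f \<in> {f. Poly_Mapping.keys f \<subseteq> A}"
        using keys_smul_subset[of k f] by auto
      assume "g \<in> {f. Poly_Mapping.keys f \<subseteq> A}"
      with f show "f + g \<in> {f. Poly_Mapping.keys f \<subseteq> A}"
        using keys_add[of f g] by auto
    qed simp
    then show "span (xpow ` A) \<subseteq> {f :: 'a mpol. Poly_Mapping.keys f \<subseteq> A}"
      by (intro span_minimal) (auto simp: xpow_def)
    show "{f :: 'a mpol. Poly_Mapping.keys f \<subseteq> A} \<subseteq> span (xpow ` A)"
    proof
      fix f :: "'a mpol"
      assume "f \<in> {f. Poly_Mapping.keys f \<subseteq> A}"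
      then have "f = (\<Sum>\<epsilon>\<in>A. smul (Poly_Mapping.lookup f \<epsilon>) (xpow \<epsilon>))"
        using sum_singles[OF assms, of f] by (simp add: smul_def xpow_def mult_single)
      also have "\<dots> \<in> span (xpow ` A)"
        by (intro span_sum span_scale span_base) auto
      finally show "f \<in> span (xpow ` A)" .
    qed
  qed
qed

lemma keys_xpow_mult:
  "Poly_Mapping.keys (xpow \<gamma> * f) = (\<lambda>\<delta>. \<gamma> + \<delta>) ` Poly_Mapping.keys (f :: 'a::field mpol)"
proof
  show "Poly_Mapping.keys (xpow \<gamma> * f) \<subseteq> (\<lambda>\<delta>. \<gamma> + \<delta>) ` Poly_Mapping.keys f"
    using keys_mult[of "xpow \<gamma>" f] by (auto simp: xpow_def)
  have "xpow \<gamma> * f =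
      (\<Sum>\<delta>\<in>Poly_Mapping.keys f. Poly_Mapping.single (\<gamma> + \<delta>) (Poly_Mapping.lookup f \<delta>))"
    by (subst sum_singles[OF finite_keys order_refl, of f])
       (simp add: sum_distrib_left xpow_def mult_single)
  then have "Poly_Mapping.lookup (xpow \<gamma> * f) (\<gamma> + \<delta>) = Poly_Mapping.lookup f \<delta>" for \<delta>
    by (auto simp: lookup_sum lookup_single when_def in_keys_iff)
  then show "(\<lambda>\<delta>. \<gamma> + \<delta>) ` Poly_Mapping.keys f \<subseteq> Poly_Mapping.keys (xpow \<gamma> * f)"
    by (auto simp: in_keys_iff)
qed

lemma lin_form_superset:
  assumes "finite A" "Poly_Mapping.keys f \<subseteq> A"
  shows "lin_form \<sigma> f = (\<Sum>\<alpha>\<in>A. Poly_Mapping.lookup f \<alpha> * \<sigma> \<alpha>)"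
  unfolding lin_form_def using assms
  by (intro sum.mono_neutral_left) (auto simp: in_keys_iff)

lemma lin_form_add: "lin_form \<sigma> (f + g) = lin_form \<sigma> f + lin_form \<sigma> g"
  using keys_add[of f g]
  by (simp add: lin_form_superset[of "Poly_Mapping.keys f \<union> Poly_Mapping.keys g"]
      lookup_add distrib_right sum.distrib)

lemma lin_form_sum: "lin_form \<sigma> (\<Sum>x\<in>A. f x) = (\<Sum>x\<in>A. lin_form \<sigma> (f x))"
  by (induction A rule: infinite_finite_induct) (simp_all add: lin_form_add, simp_all add: lin_form_def)

lemma lin_form_smul: "lin_form \<sigma> (smul k f) = k * lin_form \<sigma> f"
  by (simp add: lin_form_superset[OF finite_keys keys_smul_subset]
      lin_form_superset[OF finite_keys order_refl, of _ f] lookup_smul sum_distrib_left mult.assoc)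

lemma pairing_commute: "pairing \<sigma> f g = pairing \<sigma> g f"
  by (simp add: pairing_def mult.commute)

lemma pairing_smul_right: "pairing \<sigma> f (smul k g) = k * pairing \<sigma> f g"
  unfolding pairing_def by (simp add: lin_form_smul[symmetric] smul_def mult_ac)

text \<open>
  By linearity, the pairing with \<open>g\<close> is determined by the pairings with the monomials of its support.
  With \<open>f = p\<^sub>\<beta>\<close> this is what makes a table of the pairings of \<open>p\<^sub>\<beta>\<close> with \<open>x\<^sup>\<gamma>\<close> sufficient for
  computing the \<open>q\<^sub>\<alpha>\<close>.
\<close>

lemma pairing_expand:
  assumes "finite A" "Poly_Mapping.keys g \<subseteq> A"
  shows "pairing \<sigma> f g = (\<Sum>\<gamma>\<in>A. Poly_Mapping.lookup g \<gamma> * pairing \<sigma> f (xpow \<gamma>))"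
proof -
  have "g = (\<Sum>\<gamma>\<in>A. smul (Poly_Mapping.lookup g \<gamma>) (xpow \<gamma>))"
    using sum_singles[OF assms] by (simp add: smul_def xpow_def mult_single)
  then have "pairing \<sigma> f g = pairing \<sigma> f (\<Sum>\<gamma>\<in>A. smul (Poly_Mapping.lookup g \<gamma>) (xpow \<gamma>))"
    by simp
  also have "\<dots> = (\<Sum>\<gamma>\<in>A. pairing \<sigma> f (smul (Poly_Mapping.lookup g \<gamma>) (xpow \<gamma>)))"
    by (simp add: pairing_def sum_distrib_left lin_form_sum)
  finally show ?thesis
    by (simp add: pairing_smul_right)
qed

lemma pairing_xpow_xpow: "pairing \<sigma> (xpow \<alpha>) (xpow \<gamma>) = \<sigma> (\<alpha> + \<gamma>)"
  by (simp add: pairing_def lin_form_def xpow_def mult_single)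

lemma pairing_xpow:
  assumes "finite A" "Poly_Mapping.keys g \<subseteq> A"
  shows "pairing \<sigma> g (xpow \<gamma>) = (\<Sum>\<beta>\<in>A. Poly_Mapping.lookup g \<beta> * \<sigma> (\<beta> + \<gamma>))"
  using pairing_expand[OF assms, of \<sigma> "xpow \<gamma>"]
  by (simp add: pairing_commute[of \<sigma> g] pairing_xpow_xpow add.commute)

section \<open>Result and cost of the elementary counted operations\<close>

lemma fst_bind: "fst (M \<bind> F) = fst (F (fst M))"
  and snd_bind: "snd (M \<bind> F) = snd M + snd (F (fst M))"
  by (simp_all add: bind_counted_def split_beta)

lemmas counted_simps =
  fst_bind snd_bind ret_def addc_def subc_def mulc_def divc_def

lemma fst_foldc: "fst (foldc f xs z) = fold (\<lambda>x s. fst (f x s)) xs z"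
  by (induction xs arbitrary: z) (simp_all add: counted_simps)

lemma snd_foldc:
  assumes "\<And>x s. x \<in> set xs \<Longrightarrow> snd (f x s) = k"
  shows "snd (foldc f xs z) = length xs * k"
  using assms by (induction xs arbitrary: z) (simp_all add: counted_simps)

lemma fst_dotc: "distinct es \<Longrightarrow> fst (dotc z es u v) = z + (\<Sum>\<epsilon>\<in>set es. u \<epsilon> * v \<epsilon>)"
  unfolding dotc_def fst_foldc
  by (induction es arbitrary: z) (simp_all add: counted_simps add.assoc)

lemma snd_dotc: "snd (dotc z es u v) = 2 * length es"
  unfolding dotc_def by (subst snd_foldc[where k = 2]) (simp_all add: counted_simps)

text \<open>
  Distinctness of \<open>es\<close> matters: a repeated exponent would have its term subtracted twice.
\<close>

lemma lookup_submulc: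
  "distinct es \<Longrightarrow> Poly_Mapping.lookup (fst (submulc es g u f)) \<epsilon> =
     Poly_Mapping.lookup g \<epsilon> - (if \<epsilon> \<in> set es then u * Poly_Mapping.lookup f \<epsilon> else 0)"
  unfolding submulc_def fst_foldc
  by (induction es arbitrary: g) (auto simp add: counted_simps lookup_update)

lemma fst_submulc:
  assumes "distinct es" "Poly_Mapping.keys f \<subseteq> set es"
  shows "fst (submulc es g u f) = g - smul u f"
  using assms(2)
  by (intro poly_mapping_eqI)
     (auto simp: lookup_submulc[OF assms(1)] lookup_minus lookup_smul in_keys_iff)

lemma snd_submulc: "snd (submulc es g u f) = 2 * length es"
  unfolding submulc_def by (subst snd_foldc[where k = 2]) (simp_all add: counted_simps)

lemma fst_momentc:
  assumes "distinct b" "Poly_Mapping.keys g \<subseteq> set b"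
  shows "fst (momentc \<sigma> b g \<gamma>) = pairing \<sigma> g (xpow \<gamma>)"
  using assms by (simp add: momentc_def fst_dotc pairing_xpow[of "set b"])

lemma fst_monic_momentc:
  assumes "distinct b" "\<alpha> \<notin> set b" "Poly_Mapping.keys g \<subseteq> insert \<alpha> (set b)"
    "Poly_Mapping.lookup g \<alpha> = 1"
  shows "fst (monic_momentc \<sigma> \<alpha> b g \<gamma>) = pairing \<sigma> g (xpow \<gamma>)"
  using assms by (simp add: monic_momentc_def fst_dotc pairing_xpow[of "insert \<alpha> (set b)"])

lemma snd_momentc: "snd (momentc \<sigma> b g \<gamma>) = 2 * length b"
  by (simp add: momentc_def snd_dotc)

lemma snd_monic_momentc: "snd (monic_momentc \<sigma> \<alpha> b g \<gamma>) = 2 * length b"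
  by (simp add: monic_momentc_def snd_dotc)

section \<open>Counted projections, search and table\<close>

lemma proj_eq_fold:
  "proj \<sigma> f (map p b) (map m b) = fold (\<lambda>\<beta> g. g - smul (pairing \<sigma> g (m \<beta>)) (p \<beta>)) b f"
  unfolding proj_def by (induction b arbitrary: f) simp_all

text \<open>
  The \<open>p\<^sub>\<beta>\<close> subtracted from \<open>x\<^sup>\<alpha>\<close> do not involve \<open>\<alpha>\<close>, so the coefficient of \<open>x\<^sup>\<alpha>\<close> remains 1.
  Therefore all intermediate polynomials have the shape for which \<open>monic_momentc\<close> computes the pairing.
\<close>

lemma proj_monic:
  assumes "\<alpha> \<notin> B" "\<And>\<beta>. \<beta> \<in> set b \<Longrightarrow> Poly_Mapping.keys (p \<beta>) \<subseteq> B"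
    "Poly_Mapping.keys g \<subseteq> insert \<alpha> B" "Poly_Mapping.lookup g \<alpha> = 1"
  shows "Poly_Mapping.keys (proj \<sigma> g (map p b) (map m b)) \<subseteq> insert \<alpha> B
    \<and> Poly_Mapping.lookup (proj \<sigma> g (map p b) (map m b)) \<alpha> = 1"
  using assms(2-) unfolding proj_eq_fold
proof (induction b arbitrary: g)
  case (Cons \<beta> b)
  have "Poly_Mapping.keys (p \<beta>) \<subseteq> B"
    using Cons.prems by simp
  then have "Poly_Mapping.lookup (p \<beta>) \<alpha> = 0"
    using assms(1) by (auto simp: in_keys_iff)
  moreover have "Poly_Mapping.keys (g - smul u (p \<beta>)) \<subseteq> insert \<alpha> B" for u
    using Cons.prems \<open>Poly_Mapping.keys (p \<beta>) \<subseteq> B\<close> by (intro keys_diff_smul_subset) auto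
  ultimately show ?case
    using Cons.prems by (simp add: Cons.IH lookup_minus lookup_smul)
qed simp

lemma keys_proj_subset:
  assumes "\<And>\<beta>. \<beta> \<in> set b \<Longrightarrow> Poly_Mapping.keys (q \<beta>) \<subseteq> C" "Poly_Mapping.keys g \<subseteq> C"
  shows "Poly_Mapping.keys (proj \<sigma> g (map q b) (map p b)) \<subseteq> C"
  using assms unfolding proj_eq_fold
  by (induction b arbitrary: g) (simp_all add: keys_diff_smul_subset)

text \<open>
  Each \<open>m\<^sub>\<beta>\<close> is a multiple of the single monomial \<open>x\<^sup>\<gamma>\<close> at the same position of \<open>c\<close>, so pairing with
  \<open>m\<^sub>\<beta>\<close> is the pairing with \<open>x\<^sup>\<gamma>\<close> times one coefficient.
\<close>

lemma fst_proj_pc: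
  assumes "distinct b" "\<alpha> \<notin> set b" "\<And>\<beta>. \<beta> \<in> set b \<Longrightarrow> Poly_Mapping.keys (p \<beta>) \<subseteq> set b"
    "list_all2 (\<lambda>\<beta> \<gamma>. Poly_Mapping.keys (m \<beta>) \<subseteq> {\<gamma>}) b c"
  shows "fst (proj_pc \<sigma> \<alpha> b c p m) = proj \<sigma> (xpow \<alpha>) (map p b) (map m b)"
proof -
  have "fold (\<lambda>(\<beta>, \<gamma>) g. fst (submulc b g
            (Poly_Mapping.lookup (m \<beta>) \<gamma> * fst (monic_momentc \<sigma> \<alpha> b g \<gamma>)) (p \<beta>))) (zip bs cs) g
        = proj \<sigma> g (map p bs) (map m bs)"
    \<comment> \<open>the lists traversed shrink in the induction, the support \<open>b\<close> of the polynomials does not\<close>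
    if "list_all2 (\<lambda>\<beta> \<gamma>. Poly_Mapping.keys (m \<beta>) \<subseteq> {\<gamma>}) bs cs" "set bs \<subseteq> set b"
      "Poly_Mapping.keys g \<subseteq> insert \<alpha> (set b)" "Poly_Mapping.lookup g \<alpha> = 1"
    for bs cs g
    using that unfolding proj_eq_fold
  proof (induction bs cs arbitrary: g rule: list_all2_induct)
    case (Cons \<beta> bs \<gamma> cs)
    have "Poly_Mapping.lookup (m \<beta>) \<gamma> * fst (monic_momentc \<sigma> \<alpha> b g \<gamma>) = pairing \<sigma> g (m \<beta>)"
      using Cons assms pairing_expand[of "{\<gamma>}" "m \<beta>" \<sigma> g] by (simp add: fst_monic_momentc)
    moreover have "Poly_Mapping.keys (g - smul (pairing \<sigma> g (m \<beta>)) (p \<beta>)) \<subseteq> insert \<alpha> (set b)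
      \<and> Poly_Mapping.lookup (g - smul (pairing \<sigma> g (m \<beta>)) (p \<beta>)) \<alpha> = 1"
      using proj_monic[of \<alpha> "set b" "[\<beta>]" p g \<sigma> m, unfolded proj_eq_fold] Cons.prems assms
      by simp
    ultimately show ?case
      using Cons assms by (simp add: fst_submulc)
  qed simp
  from this[OF assms(4) order_refl, of "xpow \<alpha>"] show ?thesis
    unfolding proj_pc_def fst_foldc by (simp add: counted_simps case_prod_unfold xpow_def)
qed

lemma snd_proj_pc:
  assumes "length b = length c"
  shows "snd (proj_pc \<sigma> \<alpha> b c p m) = length b * (4 * length b + 1)"
  unfolding proj_pc_def using assms
  by (subst snd_foldc[where k = "4 * length b + 1"])
     (auto simp: counted_simps snd_monic_momentc snd_submulc)

lemma fst_searchc: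
  assumes "distinct b" "\<alpha> \<notin> set b" "Poly_Mapping.keys p\<alpha> \<subseteq> insert \<alpha> (set b)"
    "Poly_Mapping.lookup p\<alpha> \<alpha> = 1"
  shows "fst (searchc a \<sigma> \<alpha> b p\<alpha> ts) =
    map_option (\<lambda>\<gamma>. (\<gamma>, pairing \<sigma> p\<alpha> (xpow \<gamma>)))
      (find (\<lambda>\<gamma>. xpow \<gamma> * p\<alpha> \<in> pol_span (xpow ` set a) \<and> pairing \<sigma> p\<alpha> (xpow \<gamma>) \<noteq> 0) ts)"
  by (induction ts)
     (simp_all add: counted_simps fst_monic_momentc[OF assms] pol_span_monomials keys_xpow_mult)

lemma snd_searchc: "snd (searchc a \<sigma> \<alpha> b p\<alpha> ts) \<le> 2 * length b * length ts"
  by (induction ts) (simp_all add: counted_simps snd_monic_momentc)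

lemma fst_proj_qc:
  assumes "distinct c" "\<And>\<beta>. \<beta> \<in> set b \<Longrightarrow> Poly_Mapping.keys (q \<beta>) \<subseteq> set c"
    "\<And>\<beta> \<gamma>. \<beta> \<in> set b \<Longrightarrow> \<gamma> \<in> set c \<Longrightarrow> M \<beta> \<gamma> = pairing \<sigma> (p \<beta>) (xpow \<gamma>)"
    "Poly_Mapping.keys g \<subseteq> set c"
  shows "fst (proj_qc g b c q M) = proj \<sigma> g (map q b) (map p b)"
proof -
  have fst_step: "fst (dotc 0 c (Poly_Mapping.lookup h) (M \<beta>) \<bind> (\<lambda>u. submulc c h u (q \<beta>))) =
      h - smul (pairing \<sigma> h (p \<beta>)) (q \<beta>)"
    if "\<beta> \<in> set b" "Poly_Mapping.keys h \<subseteq> set c" for \<beta> h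
  proof -
    have "fst (dotc 0 c (Poly_Mapping.lookup h) (M \<beta>)) =
        (\<Sum>\<gamma>\<in>set c. Poly_Mapping.lookup h \<gamma> * pairing \<sigma> (p \<beta>) (xpow \<gamma>))"
      unfolding fst_dotc[OF assms(1)] using assms(3) that(1) by simp
    also have "\<dots> = pairing \<sigma> h (p \<beta>)"
      using that(2) by (simp only: pairing_commute[of \<sigma> h] pairing_expand[of "set c" h] List.finite_set)
    finally show ?thesis
      using assms(2) that(1) by (simp add: fst_bind fst_submulc[OF assms(1)])
  qed
  have "fold (\<lambda>\<beta> g. fst (dotc 0 c (Poly_Mapping.lookup g) (M \<beta>) \<bind> (\<lambda>u. submulc c g u (q \<beta>)))) bs h =
      fold (\<lambda>\<beta> g. g - smul (pairing \<sigma> g (p \<beta>)) (q \<beta>)) bs h"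
    if "set bs \<subseteq> set b" "Poly_Mapping.keys h \<subseteq> set c" for bs h
    using that
  proof (induction bs arbitrary: h)
    case (Cons \<beta> bs)
    then show ?case
      using assms(2) by (simp add: fst_step keys_diff_smul_subset)
  qed simp
  from this[OF order_refl assms(4)] show ?thesis
    unfolding proj_qc_def fst_foldc proj_eq_fold .
qed

lemma snd_proj_qc: "snd (proj_qc g b c q M) = length b * (4 * length c)"
  unfolding proj_qc_def
  by (subst snd_foldc[where k = "4 * length c"]) (simp_all add: counted_simps snd_dotc snd_submulc)

lemma fold_update_row:
  "fold (\<lambda>\<gamma> M. M(\<alpha> := (M \<alpha>)(\<gamma> := v \<gamma>))) c M =
    (\<lambda>x y. if x = \<alpha> \<and> y \<in> set c then v y else M x y)"
  by (induction c arbitrary: M) (auto simp: fun_eq_iff)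

lemma fold_update_column:
  "fold (\<lambda>\<beta> M. M(\<beta> := (M \<beta>)(\<gamma> := v \<beta>))) b M =
    (\<lambda>x y. if y = \<gamma> \<and> x \<in> set b then v x else M x y)"
  by (induction b arbitrary: M) (auto simp: fun_eq_iff)

text \<open>
  The column of \<open>\<gamma>\<close> and the row of \<open>\<alpha>\<close> are exactly what the old table lacks on the enlarged lists;
  their common entry is the pairing already found by the search.
\<close>

lemma fst_extend_tablec:
  assumes "distinct b" "\<And>\<beta>. \<beta> \<in> set b \<Longrightarrow> Poly_Mapping.keys (p \<beta>) \<subseteq> set b"
    "\<alpha> \<notin> set b" "Poly_Mapping.keys p\<alpha> \<subseteq> insert \<alpha> (set b)" "Poly_Mapping.lookup p\<alpha> \<alpha> = 1"
    "\<And>\<beta> \<gamma>. \<beta> \<in> set b \<Longrightarrow> \<gamma> \<in> set c \<Longrightarrow> M \<beta> \<gamma> = pairing \<sigma> (p \<beta>) (xpow \<gamma>)"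
    "\<beta> \<in> insert \<alpha> (set b)" "\<gamma>' \<in> insert \<gamma> (set c)"
  shows "fst (extend_tablec \<sigma> b c p \<alpha> \<gamma> p\<alpha> (pairing \<sigma> p\<alpha> (xpow \<gamma>)) M) \<beta> \<gamma>'
    = pairing \<sigma> ((p(\<alpha> := p\<alpha>)) \<beta>) (xpow \<gamma>')"
  using assms
  by (auto simp: extend_tablec_def counted_simps fst_foldc fold_update_row fold_update_column
      fst_momentc fst_monic_momentc)

lemma snd_extend_tablec:
  assumes "length b = length c"
  shows "snd (extend_tablec \<sigma> b c p \<alpha> \<gamma> p\<alpha> w M) = 4 * length b * length b"
  using assms
  by (simp add: extend_tablec_def counted_simps snd_foldc[where k = "2 * length b"]
      snd_momentc snd_monic_momentc)

section \<open>Invariant and amortised cost\<close>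

text \<open>
  The list \<open>ns\<close> holds the exponents of the current round that still await treatment; it is a separate
  argument because \<open>n_of\<close> keeps its value during a round.  The second alternative
  of the disjunction covers the treatment of \<open>0\<close>, which lies in no border: it holds at the start, and also at the end if
  \<open>0\<close> is rejected.
\<close>

definition ag_inv ::
    "nat \<Rightarrow> expo list \<Rightarrow> (expo \<Rightarrow> 'a::field) \<Rightarrow> expo list \<Rightarrow> 'a cagstate \<Rightarrow> bool" where
  "ag_inv n a \<sigma> ns S \<longleftrightarrow>
     distinct (b_of S @ d_of S @ s_of S) \<and> set (b_of S @ d_of S @ s_of S) \<subseteq> set a \<and>
     distinct (c_of S @ t_of S) \<and> set (c_of S @ t_of S) \<subseteq> set a \<and>
     distinct ns \<and> set ns \<subseteq> set (s_of S) \<and>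
     (set (d_of S @ ns) \<subseteq> exp_plus n (set (b_of S)) \<or> b_of S = [] \<and> set (d_of S @ ns) \<subseteq> {0}) \<and>
     (\<forall>\<beta>\<in>set (b_of S). Poly_Mapping.keys (p_of S \<beta>) \<subseteq> set (b_of S)) \<and>
     (\<forall>\<beta>\<in>set (b_of S). Poly_Mapping.keys (q_of S \<beta>) \<subseteq> set (c_of S)) \<and>
     list_all2 (\<lambda>\<beta> \<gamma>. Poly_Mapping.keys (m_of S \<beta>) \<subseteq> {\<gamma>}) (b_of S) (c_of S) \<and>
     (\<forall>\<beta>\<in>set (b_of S). \<forall>\<gamma>\<in>set (c_of S). M_of S \<beta> \<gamma> = pairing \<sigma> (p_of S \<beta>) (xpow \<gamma>))"

text \<open>
  A bound on the cost so far in which the final \<open>r\<close> and \<open>\<delta>\<close> are replaced by the current numbers of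
  accepted and rejected exponents.  It grows by at least \<open>20 l' s\<close> at each treatment that ends with
  \<open>l'\<close> accepted exponents.
\<close>

definition ops_bound :: "expo list \<Rightarrow> 'a cagstate \<Rightarrow> nat" where
  "ops_bound a S =
     20 * ((length (b_of S) + length (d_of S)) * length (b_of S) * length a)"

lemma exp_plus_mono: "E \<subseteq> F \<Longrightarrow> exp_plus n E \<subseteq> exp_plus n F"
  by (auto simp: exp_plus_def)

lemma subset_exp_plus: "E \<subseteq> exp_plus n E"
  by (auto simp: exp_plus_def)

text \<open>
  With \<open>l\<close> accepted exponents, the projection giving \<open>p\<^sub>\<alpha>\<close> costs \<open>4 l\<^sup>2 + l\<close> and the search at most
  \<open>2 l s\<close>, together at most \<open>7 l s\<close>.  If \<open>\<alpha>\<close> is accepted, one division, \<open>4 l\<^sup>2\<close> for the table and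
  \<open>4 l (l + 1)\<close> for \<open>q\<^sub>\<alpha>\<close> are added.  The total is at most \<open>20 (l + 1) s\<close>; this is where the
  constant 20 comes from.
\<close>

lemma ag_treatc_correct:
  assumes inv: "ag_inv n a \<sigma> (\<alpha> # ns) S" and "distinct a"
  defines "S' \<equiv> fst (ag_treatc a \<sigma> \<alpha> S)"
  shows "ag_treat a \<sigma> \<alpha> (agstate.truncate S) = agstate.truncate S'"
    and "ag_inv n a \<sigma> ns S'"
    and "ops_bound a S + snd (ag_treatc a \<sigma> \<alpha> S) \<le> ops_bound a S'"
    and "length (s_of S') < length (s_of S)"
proof -
  define b c p m q where
    "b = b_of S" and "c = c_of S" and "p = p_of S" and "m = m_of S" and "q = q_of S"
  note S_defs = b_def c_def p_def m_def q_def
  define p\<alpha> where "p\<alpha> = proj \<sigma> (xpow \<alpha>) (map p b) (map m b)"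
  have dist_b: "distinct b" and \<alpha>_notin: "\<alpha> \<notin> set b" "\<alpha> \<notin> set (d_of S)"
    and \<alpha>_in: "\<alpha> \<in> set (s_of S)"
    and dist_c: "distinct c" and p_keys: "\<And>\<beta>. \<beta> \<in> set b \<Longrightarrow> Poly_Mapping.keys (p \<beta>) \<subseteq> set b"
    and q_keys: "\<And>\<beta>. \<beta> \<in> set b \<Longrightarrow> Poly_Mapping.keys (q \<beta>) \<subseteq> set c"
    and m_keys: "list_all2 (\<lambda>\<beta> \<gamma>. Poly_Mapping.keys (m \<beta>) \<subseteq> {\<gamma>}) b c"
    and M: "\<And>\<beta> \<gamma>. \<beta> \<in> set b \<Longrightarrow> \<gamma> \<in> set c \<Longrightarrow> M_of S \<beta> \<gamma> = pairing \<sigma> (p \<beta>) (xpow \<gamma>)"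
    using inv by (auto simp: ag_inv_def S_defs)
  have len: "length b = length c"
    using m_keys by (rule list_all2_lengthD)
  \<comment> \<open>\<open>\<alpha>\<close> is an element of \<open>a\<close> outside \<open>b\<close>\<close>
  have b_less: "length b < length a"
  proof -
    have "distinct (\<alpha> # b)" "set (\<alpha> # b) \<subseteq> set a"
      using inv dist_b \<alpha>_notin by (auto simp: ag_inv_def S_defs)
    then have "length (\<alpha> # b) \<le> length a"
      by (metis distinct_card card_length card_mono List.finite_set order_trans)
    then show ?thesis by simp
  qed
  have t_le: "length (t_of S) \<le> length a"
    using inv unfolding ag_inv_def
    by (metis distinct_append distinct_card card_length card_mono List.finite_set order_trans
        set_append Un_subset_iff)
  have p\<alpha>: "Poly_Mapping.keys p\<alpha> \<subseteq> insert \<alpha> (set b)" "Poly_Mapping.lookup p\<alpha> \<alpha> = 1"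
    using proj_monic[of \<alpha> "set b" b p "xpow \<alpha>" \<sigma> m] \<alpha>_notin p_keys
    by (auto simp: p\<alpha>_def xpow_def)
  have fst_p: "fst (proj_pc \<sigma> \<alpha> b c p m) = p\<alpha>"
    unfolding p\<alpha>_def by (rule fst_proj_pc) (use dist_b \<alpha>_notin p_keys m_keys in auto)
  have len_s: "length (remove1 \<alpha> (s_of S)) < length (s_of S)"
    using \<alpha>_in length_pos_if_in_set[OF \<alpha>_in] by (simp add: length_remove1)
  have s_set: "set (remove1 \<alpha> (s_of S)) = set (s_of S) - {\<alpha>}"
    using inv by (simp add: ag_inv_def)
  let ?found = "find (\<lambda>\<gamma>. xpow \<gamma> * p\<alpha> \<in> pol_span (xpow ` set a) \<and> pairing \<sigma> p\<alpha> (xpow \<gamma>) \<noteq> 0) (t_of S)"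
  have fst_search: "fst (searchc a \<sigma> \<alpha> b p\<alpha> (t_of S)) =
      map_option (\<lambda>\<gamma>. (\<gamma>, pairing \<sigma> p\<alpha> (xpow \<gamma>))) ?found"
    using dist_b \<alpha>_notin p\<alpha> by (intro fst_searchc)
  have "snd (searchc a \<sigma> \<alpha> b p\<alpha> (t_of S)) \<le> 2 * length b * length a"
    using snd_searchc t_le by (meson mult_le_mono2 order_trans)
  moreover have "length b * length b \<le> length b * length a" "length b \<le> length b * length a"
    using b_less by auto
  moreover have "length b * (4 * length b + 1) = 4 * (length b * length b) + length b"
    by (simp add: algebra_simps)
  ultimately have cost_ab:
    "snd (proj_pc \<sigma> \<alpha> b c p m) + snd (searchc a \<sigma> \<alpha> b p\<alpha> (t_of S)) \<le> 7 * (length b * length a)"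
    unfolding snd_proj_pc[OF len] by linarith
  have "ag_treat a \<sigma> \<alpha> (agstate.truncate S) = agstate.truncate S' \<and> ag_inv n a \<sigma> ns S' \<and>
      ops_bound a S + snd (ag_treatc a \<sigma> \<alpha> S) \<le> ops_bound a S' \<and> length (s_of S') < length (s_of S)"
  proof (cases ?found)
    case None
    have S': "S' = S\<lparr>d_of := d_of S @ [\<alpha>], s_of := remove1 \<alpha> (s_of S), p_of := p(\<alpha> := p\<alpha>)\<rparr>"
      unfolding S'_def ag_treatc_def Let_def S_defs[symmetric]
      using None by (simp add: counted_simps fst_p fst_search)
    have cost: "snd (ag_treatc a \<sigma> \<alpha> S) \<le> 7 * (length b * length a)"
      unfolding ag_treatc_def Let_def S_defs[symmetric]
      using cost_ab None by (simp add: counted_simps fst_p fst_search)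
    have "ag_treat a \<sigma> \<alpha> (agstate.truncate S) = agstate.truncate S'"
      using None unfolding S' by (simp add: ag_treat_def agstate.defs p\<alpha>_def S_defs Let_def)
    moreover have "ag_inv n a \<sigma> ns S'"
      using inv \<alpha>_notin \<alpha>_in s_set unfolding S' ag_inv_def by (auto simp: S_defs)
    moreover have "ops_bound a S + snd (ag_treatc a \<sigma> \<alpha> S) \<le> ops_bound a S'"
      using cost by (simp add: S' ops_bound_def b_def algebra_simps)
    ultimately show ?thesis
      using len_s by (simp add: S')
  next
    case (Some \<gamma>)
    define w where "w = pairing \<sigma> p\<alpha> (xpow \<gamma>)"
    define m\<alpha> where "m\<alpha> = Poly_Mapping.single \<gamma> (1 / w)"
    define M' where "M' = fst (extend_tablec \<sigma> b c p \<alpha> \<gamma> p\<alpha> w (M_of S))"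
    define q\<alpha> where "q\<alpha> = proj \<sigma> m\<alpha> (map q b) (map p b)"
    have \<gamma>_in: "\<gamma> \<in> set (t_of S)"
      using Some unfolding find_Some_iff by (elim exE conjE) (simp only: nth_mem)
    then have \<gamma>_notin: "\<gamma> \<notin> set c"
      using inv by (auto simp: ag_inv_def S_defs)
    have m\<alpha>_keys: "Poly_Mapping.keys m\<alpha> \<subseteq> {\<gamma>}"
      by (simp add: m\<alpha>_def)
    have M': "M' \<beta> \<gamma>' = pairing \<sigma> ((p(\<alpha> := p\<alpha>)) \<beta>) (xpow \<gamma>')"
      if "\<beta> \<in> insert \<alpha> (set b)" "\<gamma>' \<in> insert \<gamma> (set c)" for \<beta> \<gamma>'
      unfolding M'_def w_def
      by (rule fst_extend_tablec) (use dist_b \<alpha>_notin p_keys p\<alpha> M that in auto)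
    have fst_q: "fst (proj_qc m\<alpha> b (c @ [\<gamma>]) q M') = q\<alpha>"
      unfolding q\<alpha>_def
    proof (rule fst_proj_qc)
      fix \<beta> \<gamma>'
      assume "\<beta> \<in> set b" "\<gamma>' \<in> set (c @ [\<gamma>])"
      then show "M' \<beta> \<gamma>' = pairing \<sigma> (p \<beta>) (xpow \<gamma>')"
        using M'[of \<beta> \<gamma>'] \<alpha>_notin by auto
    qed (use dist_c \<gamma>_notin q_keys m\<alpha>_keys in auto)
    have q\<alpha>_keys: "Poly_Mapping.keys q\<alpha> \<subseteq> insert \<gamma> (set c)"
      unfolding q\<alpha>_def by (rule keys_proj_subset) (use q_keys m\<alpha>_keys in auto)
    have found: "fst (searchc a \<sigma> \<alpha> b p\<alpha> (t_of S)) = Some (\<gamma>, w)"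
      using fst_search Some by (simp add: w_def)
    have S': "S' = S\<lparr>b_of := b @ [\<alpha>], s_of := remove1 \<alpha> (s_of S),
                c_of := c @ [\<gamma>], t_of := remove1 \<gamma> (t_of S),
                p_of := p(\<alpha> := p\<alpha>), m_of := m(\<alpha> := m\<alpha>), q_of := q(\<alpha> := q\<alpha>), M_of := M'\<rparr>"
      unfolding S'_def ag_treatc_def Let_def S_defs[symmetric]
      by (simp add: counted_simps fst_p found M'_def[symmetric] m\<alpha>_def[symmetric] fst_q)
    have "snd (ag_treatc a \<sigma> \<alpha> S) \<le>
        7 * (length b * length a) + 1 + 4 * length b * length b + length b * (4 * (length b + 1))"
      unfolding ag_treatc_def Let_def S_defs[symmetric]
      using cost_ab len by (simp add: counted_simps fst_p found snd_extend_tablec snd_proj_qc)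
    also have "\<dots> = 7 * (length b * length a) + 1 + 8 * (length b * length b) + 4 * length b"
      by (simp add: algebra_simps)
    also have "\<dots> \<le> 20 * (length b * length a + length a)"
    proof -
      have "7 * x + 1 + 8 * y + 4 * l \<le> 20 * (x + s)" if "y \<le> x" "l \<le> x" "l < s" for x y l s :: nat
        using that by simp
      then show ?thesis
        using \<open>length b * length b \<le> length b * length a\<close> \<open>length b \<le> length b * length a\<close> b_less
        by blast
    qed
    finally have cost: "snd (ag_treatc a \<sigma> \<alpha> S) \<le> 20 * (length b * length a + length a)" .
    have smul_xpow: "smul (1 / w) (xpow \<gamma>) = m\<alpha>"
      by (simp add: m\<alpha>_def smul_def xpow_def mult_single)
    have t_set: "set (remove1 \<gamma> (t_of S)) = set (t_of S) - {\<gamma>}"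
      using inv by (simp add: ag_inv_def)
    have "ag_treat a \<sigma> \<alpha> (agstate.truncate S) = agstate.truncate S'"
      using Some smul_xpow unfolding S'
      by (simp add: ag_treat_def agstate.defs p\<alpha>_def q\<alpha>_def w_def S_defs Let_def)
    moreover have "ag_inv n a \<sigma> ns S'"
    proof -
      have "distinct (b_of S' @ d_of S' @ s_of S')" "set (b_of S' @ d_of S' @ s_of S') \<subseteq> set a"
        "distinct (c_of S' @ t_of S')" "set (c_of S' @ t_of S') \<subseteq> set a"
        "distinct ns" "set ns \<subseteq> set (s_of S')"
        using inv s_set t_set \<alpha>_in \<gamma>_in unfolding S' ag_inv_def
        by (auto simp: S_defs)
      moreover have "set (d_of S' @ ns) \<subseteq> exp_plus n (set (b_of S'))"
      proof -
        consider "set (d_of S @ \<alpha> # ns) \<subseteq> exp_plus n (set b)"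
          | "set (d_of S @ \<alpha> # ns) \<subseteq> {0}"
          using inv by (auto simp: ag_inv_def S_defs)
        then show ?thesis
        proof cases
          case 1
          then show ?thesis
            using exp_plus_mono[of "set b" "insert \<alpha> (set b)" n] by (auto simp: S')
        next
          case 2
          \<comment> \<open>here \<open>\<alpha> = 0\<close>, so accepting it leads to the first alternative\<close>
          then have "set (d_of S @ ns) \<subseteq> insert \<alpha> (set b)"
            by auto
          then show ?thesis
            using subset_exp_plus[of "insert \<alpha> (set b)" n] by (auto simp: S')
        qed
      qed
      moreover have "\<forall>\<beta>\<in>set (b_of S'). Poly_Mapping.keys (p_of S' \<beta>) \<subseteq> set (b_of S')"
        using p_keys p\<alpha> by (auto simp: S')
      moreover have "\<forall>\<beta>\<in>set (b_of S'). Poly_Mapping.keys (q_of S' \<beta>) \<subseteq> set (c_of S')"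
        using q_keys q\<alpha>_keys by (auto simp: S')
      moreover have "list_all2 (\<lambda>\<beta> \<gamma>. Poly_Mapping.keys (m_of S' \<beta>) \<subseteq> {\<gamma>}) (b_of S') (c_of S')"
      proof -
        have "list_all2 (\<lambda>\<beta> \<gamma>. Poly_Mapping.keys ((m(\<alpha> := m\<alpha>)) \<beta>) \<subseteq> {\<gamma>}) b c"
          using m_keys by (rule list.rel_mono_strong) (use \<alpha>_notin in auto)
        then show ?thesis
          using m\<alpha>_keys by (simp add: S' list_all2_appendI)
      qed
      moreover have "\<forall>\<beta>\<in>set (b_of S'). \<forall>\<gamma>\<in>set (c_of S'). M_of S' \<beta> \<gamma> = pairing \<sigma> (p_of S' \<beta>) (xpow \<gamma>)"
        using M' by (simp add: S')
      ultimately show ?thesis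
        unfolding ag_inv_def by blast
    qed
    moreover have "ops_bound a S + snd (ag_treatc a \<sigma> \<alpha> S) \<le> ops_bound a S'"
      using cost by (simp add: S' ops_bound_def b_def algebra_simps)
    ultimately show ?thesis
      using len_s by (simp add: S')
  qed
  then show "ag_treat a \<sigma> \<alpha> (agstate.truncate S) = agstate.truncate S'"
    and "ag_inv n a \<sigma> ns S'"
    and "ops_bound a S + snd (ag_treatc a \<sigma> \<alpha> S) \<le> ops_bound a S'"
    and "length (s_of S') < length (s_of S)"
    by blast+
qed

lemma fold_ag_treatc_correct:
  assumes "ag_inv n a \<sigma> ns S" "distinct a"
  shows "fold (ag_treat a \<sigma>) ns (agstate.truncate S) = agstate.truncate (fst (foldc (ag_treatc a \<sigma>) ns S))
    \<and> ag_inv n a \<sigma> [] (fst (foldc (ag_treatc a \<sigma>) ns S))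
    \<and> ops_bound a S + snd (foldc (ag_treatc a \<sigma>) ns S) \<le> ops_bound a (fst (foldc (ag_treatc a \<sigma>) ns S))
    \<and> length (s_of (fst (foldc (ag_treatc a \<sigma>) ns S))) + length ns \<le> length (s_of S)"
  using assms(1)
proof (induction ns arbitrary: S)
  case Nil
  then show ?case by (simp add: counted_simps)
next
  case (Cons \<alpha> ns)
  note treat = ag_treatc_correct[OF Cons.prems assms(2)]
  show ?case
    using treat(3,4) Cons.IH[OF treat(2)] by (simp add: counted_simps treat(1))
qed

text \<open>
  An empty \<open>b\<close> has an empty border, so the exceptional alternative of the invariant survives the
  end of a round.  The last claim gives termination, since \<open>n\<close> is nonempty as long as the loop runs.
\<close>

lemma ag_roundc_correct:
  assumes inv: "ag_inv n a \<sigma> (n_of S) S" and "distinct a" and ord: "enumerates_sets ord"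
  defines "S' \<equiv> fst (ag_roundc ord n a \<sigma> S)"
  shows "ag_round ord n a \<sigma> (agstate.truncate S) = agstate.truncate S'"
    and "ag_inv n a \<sigma> (n_of S') S'"
    and "ops_bound a S + snd (ag_roundc ord n a \<sigma> S) \<le> ops_bound a S'"
    and "length (s_of S') + length (n_of S) \<le> length (s_of S)"
proof -
  define T where "T = fst (foldc (ag_treatc a \<sigma>) (n_of S) S)"
  define N where "N = next_exps n a (b_of T) (d_of T) (c_of T) (s_of T)"
  note T = fold_ag_treatc_correct[OF inv assms(2), folded T_def]
  have S': "S' = T\<lparr>n_of := ord N\<rparr>"
    by (simp add: S'_def ag_roundc_def counted_simps T_def N_def)
  have "finite N"
    by (rule finite_subset[of _ "set (s_of T)"]) (auto simp: N_def next_exps_def)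
  then have ord_N: "distinct (ord N)" "set (ord N) = N"
    using ord by (auto simp: enumerates_sets_def)
  have [simp]: "n_of (agstate.truncate S) = n_of S"
    by (simp add: agstate.defs)
  show "ag_round ord n a \<sigma> (agstate.truncate S) = agstate.truncate S'"
    using T by (simp add: ag_round_def S' N_def Let_def) (simp add: agstate.defs)
  have N_border: "N \<subseteq> border n (set (b_of T)) \<inter> set (s_of T)"
    by (auto simp: N_def next_exps_def)
  moreover have "border n (set (b_of T)) = {}" if "b_of T = []"
    using that by (simp add: border_def exp_plus_def)
  moreover have "border n (set (b_of T)) \<subseteq> exp_plus n (set (b_of T))"
    by (auto simp: border_def)
  ultimately show "ag_inv n a \<sigma> (n_of S') S'"
    using T ord_N unfolding S' ag_inv_def by auto
  show "ops_bound a S + snd (ag_roundc ord n a \<sigma> S) \<le> ops_bound a S'"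
    using T by (simp add: ag_roundc_def counted_simps S' ops_bound_def T_def)
  show "length (s_of S') + length (n_of S) \<le> length (s_of S)"
    using T by (simp add: S')
qed

text \<open>
  For nonempty \<open>b\<close> the rejected exponents lie in the border, so there are at most \<open>\<delta>\<close> of them.  For
  empty \<open>b\<close> one exponent may have been rejected although the border is empty, but then the factor
  \<open>r = 0\<close> makes both sides vanish.
\<close>

lemma ops_bound_border:
  assumes "ag_inv n a \<sigma> ns S" "distinct a"
  shows "ops_bound a S \<le> 20 * ((card (set (b_of S)) + card (border n (set (b_of S))))
    * card (set (b_of S)) * card (set a))"
proof (cases "b_of S = []")
  case True
  then show ?thesis by (simp add: ops_bound_def)
next
  case False
  have "set (d_of S) \<subseteq> border n (set (b_of S))"
    using assms(1) False by (auto simp: ag_inv_def border_def)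
  moreover have "finite (border n (set (b_of S)))"
    by (simp add: border_def exp_plus_def)
  ultimately have "card (set (d_of S)) \<le> card (border n (set (b_of S)))"
    by (rule card_mono[rotated])
  moreover have "card (set (d_of S)) = length (d_of S)" "card (set (b_of S)) = length (b_of S)"
    "card (set a) = length a"
    using assms by (auto simp: ag_inv_def distinct_card)
  ultimately show ?thesis
    by (simp add: ops_bound_def)
qed

section \<open>The complexity bound\<close>

text \<open>
  The uncounted run is the image of the counted one under forgetting the table and the counter, which
  transfers both termination and the output.
\<close>

theorem proposition3p7:
  "\<exists>C::nat. \<forall>(n::nat) (a::expo list) (\<sigma>::expo \<Rightarrow> 'a::field) ord.
     distinct a \<longrightarrow> set a \<subseteq> exponents n \<longrightarrow> connected_to_0 n (set a) \<longrightarrow> enumerates_sets ord \<longrightarrow>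
     (\<exists>b c p q k ops.
        ag_border_basis ord n a \<sigma> = Some (b, c, p, q, k) \<and>
        ag_border_basisc ord n a \<sigma> = Some ((b, c, p, q, k), ops) \<and>
        (let s = card (set a); r = card (set b); \<delta> = card (border n (set b))
         in ops \<le> C * ((r + \<delta>) * r * s)))"
proof (intro exI[of _ 20] allI impI)
  fix n :: nat and a :: "expo list" and \<sigma> :: "expo \<Rightarrow> 'a" and ord
  assume "distinct a" and "connected_to_0 n (set a)" and ord: "enumerates_sets ord"
  define P where "P = (\<lambda>(S :: 'a cagstate, ops). ag_inv n a \<sigma> (n_of S) S \<and> ops \<le> ops_bound a S)"
  define run where "run = (\<lambda>(S :: 'a cagstate, ops :: nat). n_of S \<noteq> [])"
  define step where "step = (\<lambda>(S, ops :: nat). (S, ops) \<bind> ag_roundc ord n a \<sigma>)"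
  define forget where "forget = (\<lambda>X :: 'a cagstate counted. agstate.truncate (fst X))"
  define X0 where "X0 = (ag_initc a :: 'a cagstate, 0 :: nat)"
  have init: "P X0"
    using \<open>distinct a\<close> \<open>connected_to_0 n (set a)\<close>
    by (auto simp: X0_def P_def ag_inv_def ag_initc_def ag_init_def agstate.defs cagstate.defs
        connected_to_0_def)
  have step_P: "P (step X) \<and> length (s_of (fst (step X))) < length (s_of (fst X))
      \<and> forget (step X) = ag_round ord n a \<sigma> (forget X)"
    if "P X" "run X" for X
  proof -
    obtain S ops where X: "X = (S, ops)" by fastforce
    have inv: "ag_inv n a \<sigma> (n_of S) S" and "ops \<le> ops_bound a S"
      using that by (auto simp: X P_def)
    note round = ag_roundc_correct[OF inv \<open>distinct a\<close> ord]
    have "0 < length (n_of S)"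
      using that by (simp add: X run_def)
    then have "length (s_of (fst (ag_roundc ord n a \<sigma> S))) < length (s_of S)"
      using round(4) by linarith
    moreover have "step X = (fst (ag_roundc ord n a \<sigma> S), ops + snd (ag_roundc ord n a \<sigma> S))"
      by (simp add: step_def X bind_counted_def split_beta)
    ultimately show ?thesis
      using round(1-3) \<open>ops \<le> ops_bound a S\<close> by (auto simp: P_def forget_def X)
  qed
  have "\<exists>X. while_option run step X0 = Some X"
    using init step_P
    by (intro measure_while_option_Some[of P run step "\<lambda>X. length (s_of (fst X))"]) auto
  then obtain S ops where final: "while_option run step X0 = Some (S, ops)"
    by fastforce
  have "P (S, ops)"
    using while_option_rule[OF _ final, of P] init step_P by blast
  have "map_option forget (while_option run step X0)
      = while_option (\<lambda>S. n_of S \<noteq> []) (ag_round ord n a \<sigma>) (forget X0)"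
    by (rule while_option_commute_invariant[of P])
       (use init step_P in \<open>auto simp: run_def forget_def agstate.defs\<close>)
  moreover have "forget X0 = ag_init a"
    by (simp add: forget_def X0_def ag_initc_def agstate.defs)
  ultimately have "while_option (\<lambda>S. n_of S \<noteq> []) (ag_round ord n a \<sigma>) (ag_init a)
      = Some (agstate.truncate S)"
    by (simp add: final forget_def)
  then have plain: "ag_border_basis ord n a \<sigma> = Some (ag_output S)"
    by (simp add: ag_border_basis_def ag_output_def agstate.defs)
  have counted: "ag_border_basisc ord n a \<sigma> = Some (ag_output S, ops)"
    using final unfolding ag_border_basisc_def run_def step_def X0_def ret_def by simp
  have "ops \<le> 20 * ((card (set (b_of S)) + card (border n (set (b_of S))))
      * card (set (b_of S)) * card (set a))"
    using \<open>P (S, ops)\<close> ops_bound_border[of n a \<sigma> "n_of S" S] \<open>distinct a\<close>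
    by (auto simp: P_def)
  with plain counted show "\<exists>b c p q k ops.
        ag_border_basis ord n a \<sigma> = Some (b, c, p, q, k) \<and>
        ag_border_basisc ord n a \<sigma> = Some ((b, c, p, q, k), ops) \<and>
        (let s = card (set a); r = card (set b); \<delta> = card (border n (set b))
         in ops \<le> 20 * ((r + \<delta>) * r * s))"
    by (auto simp: ag_output_def Let_def)
qed

end
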